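(* Let $k\ge1$ be an integer. The restricted wreath product $\mathbb{Z}_3\,\mathrm{wr}\,\mathbb{Z}^k$ has the property $R_\infty$ if $k$ is odd, and does not have the property $R_\infty$ if $k$ is even.
   Context: For an automorphism $\phi$ of a group $G$, $R(\phi)$ is the number of classes of the relation $g\sim hg\phi(h^{-1})$, $h,g\in G$. A group has property $R_\infty$ if $R(\phi)=\infty$ for every automorphism $\phi$. $\mathbb{Z}_3\,\mathrm{wr}\,\mathbb{Z}^k=\left(\bigoplus_{x\in\mathbb{Z}^k}A_x\right)\rtimes_\alpha\mathbb{Z}^k$, with $A_x\cong\mathbb{Z}_3$ generated by $\delta_x$, finitely supported direct sum, and $\alpha(y)(\delta_x)=\delta_{y+x}$. *)

theory Defs
  imports "HOL-Algebra.Group"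
begin

definition zk :: "nat \<Rightarrow> (nat \<Rightarrow> int) set" where
  "zk k = {v. \<forall>i\<ge>k. v i = 0}"

definition lamp :: "nat \<Rightarrow> ((nat \<Rightarrow> int) \<Rightarrow> int) set" where
  "lamp k = {a. (\<forall>x. a x \<in> {0,1,2}) \<and> (\<forall>x. x \<notin> zk k \<longrightarrow> a x = 0)
               \<and> finite {x. a x \<noteq> 0}}"

text \<open>Restricted wreath product Z_3 wr Z^k: pairs (a,y) with
  (a,y)(b,z) = (a + alpha(y) b, y + z), where (alpha(y) b)(x) = b(x - y),
  so that alpha(y)(delta_x) = delta_(y+x).\<close>
definition wreath :: "nat \<Rightarrow> (((nat \<Rightarrow> int) \<Rightarrow> int) \<times> (nat \<Rightarrow> int)) monoid" where
  "wreath k = \<lparr> carrier = lamp k \<times> zk k,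
     mult = (\<lambda>(a, y) (b, z). ((\<lambda>x. (a x + b (\<lambda>i. x i - y i)) mod 3), (\<lambda>i. y i + z i))),
     one = ((\<lambda>_. 0), (\<lambda>_. 0)) \<rparr>"

definition twisted_conj :: "('a, 'b) monoid_scheme \<Rightarrow> ('a \<Rightarrow> 'a) \<Rightarrow> ('a \<times> 'a) set" where
  "twisted_conj G \<phi> = {(g, g'). g \<in> carrier G \<and> g' \<in> carrier G \<and>
      (\<exists>h\<in>carrier G. g' = h \<otimes>\<^bsub>G\<^esub> g \<otimes>\<^bsub>G\<^esub> \<phi> (inv\<^bsub>G\<^esub> h))}"

definition reidemeister_classes :: "('a, 'b) monoid_scheme \<Rightarrow> ('a \<Rightarrow> 'a) \<Rightarrow> 'a set set" where
  "reidemeister_classes G \<phi> = carrier G // twisted_conj G \<phi>"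

definition R_infty :: "('a, 'b) monoid_scheme \<Rightarrow> bool" where
  "R_infty G \<longleftrightarrow> (\<forall>\<phi>\<in>iso G G. infinite (reidemeister_classes G \<phi>))"

end

theory Submission
  imports Defs "HOL-Library.Function_Algebras" "HOL-Library.Fun_Lexorder"
    "HOL-Number_Theory.Cong" "Jordan_Normal_Form.Char_Poly"
begin

text \<open>
  The base group \<open>N\<close>, the group ring of \<open>\<int>\<^sup>k\<close> over the field with three elements, is the torsion of
  the wreath product. So an automorphism induces \<open>M\<close> in \<open>GL(k, \<int>)\<close> on the quotient and an
  \<open>M\<close>-semilinear bijection of \<open>N\<close>; as all units of the group ring are monomials, the latter
  maps the generator at \<open>x\<close> to \<open>e\<close> times the generator at \<open>p + M x\<close>, with \<open>e = 1\<close> or \<open>e = -1\<close>.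

  For odd \<open>k\<close>, the transpose of \<open>M\<close> has a real eigenvector \<open>w\<close> with eigenvalue \<open>r\<close>. If \<open>r = 1\<close>, or if
  \<open>M\<close> fixes a nonzero vector, an invariant functional separates infinitely many classes. Otherwise
  choose a unit vector \<open>v\<close> with \<open>w \<bullet> v \<noteq> 0\<close>: an odd period of \<open>v\<close> would force \<open>r = 1\<close>. Orbits without
  an odd period carry an invariant functional on \<open>N\<close> for either value of \<open>e\<close>, and the multiples
  \<open>n v\<close> lie in different orbits, which gives infinitely many classes.

  For even \<open>k\<close>, take \<open>e = -1\<close> and for \<open>M\<close> a block matrix with \<open>1 + M + M\<^sup>2 = 0\<close>. All orbits, also after
  translation, have length 1 or 3, so the base group contributes a single class, and \<open>1 - M\<close> divides 3.
\<close>

section \<open>Additive maps of the exponent lattice\<close>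

text \<open>In odd degree the reflected polynomial \<open>q\<close> also has positive leading
  coefficient. Hence \<open>p\<close> is positive far to the right and negative far to the left, and
  the intermediate value theorem applies.\<close>

lemma odd_degree_real_root:
  fixes p :: "real poly"
  assumes "odd (degree p)" "lead_coeff p > 0"
  obtains x where "poly p x = 0"
proof -
  define q where "q = - (p \<circ>\<^sub>p [:0, -1:])"
  have q: "poly q x = - poly p (- x)" for x
    by (simp add: q_def poly_pcompose)
  have "lead_coeff (p \<circ>\<^sub>p [:0, -1:]) = - lead_coeff p"
    using assms(1) by (subst lead_coeff_comp) simp_all
  hence lq: "lead_coeff q > 0"
    using assms(2) by (simp add: q_def)
  obtain m where m: "\<And>x. x \<ge> m \<Longrightarrow> lead_coeff p \<le> poly p x"
    using poly_pinfty_gt_lc[OF assms(2)] by blast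
  obtain n where n: "\<And>x. x \<ge> n \<Longrightarrow> lead_coeff q \<le> poly q x"
    using poly_pinfty_gt_lc[OF lq] by blast
  define b where "b = max 1 (max m n)"
  have b: "b \<ge> m" "b \<ge> n" "b \<ge> 1"
    by (simp_all add: b_def)
  have "poly p b > 0"
    using m[OF b(1)] assms(2) by linarith
  moreover have "poly p (- b) < 0"
    using n[OF b(2)] lq q[of b] by linarith
  moreover have "- b < b"
    using b(3) by linarith
  ultimately show ?thesis
    using poly_IVT_pos that by blast
qed

section \<open>The lattice of exponents and its endomorphisms\<close>

lemma zk_zero [simp]: "0 \<in> zk k"
  and zk_add: "x \<in> zk k \<Longrightarrow> y \<in> zk k \<Longrightarrow> x + y \<in> zk k"
  and zk_uminus: "x \<in> zk k \<Longrightarrow> - x \<in> zk k"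
  and zk_scale: "x \<in> zk k \<Longrightarrow> (\<lambda>i. c * x i) \<in> zk k"
  by (auto simp: zk_def)

text \<open>Polymorphic because it serves twice: as a multiple of a unit vector of the lattice, and
  as a multiple of a generator of the base group.\<close>

definition single :: "'a \<Rightarrow> int \<Rightarrow> 'a \<Rightarrow> int" where
  "single x c = (\<lambda>_. 0)(x := c)"

lemma single_apply [simp]: "single x c y = (if y = x then c else 0)"
  by (simp add: single_def)

lemma single_in_zk: "i < k \<Longrightarrow> single i c \<in> zk k"
  by (auto simp: zk_def)

locale zk_endo =
  fixes k :: nat and M :: "(nat \<Rightarrow> int) \<Rightarrow> (nat \<Rightarrow> int)"
  assumes closed: "x \<in> zk k \<Longrightarrow> M x \<in> zk k"
    and add: "x \<in> zk k \<Longrightarrow> y \<in> zk k \<Longrightarrow> M (x + y) = M x + M y"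
begin

lemma zero: "M 0 = 0"
  using add[of 0 0] by simp

lemma uminus: "x \<in> zk k \<Longrightarrow> M (- x) = - M x"
  using add[of x "- x"] by (simp add: zero zk_uminus eq_neg_iff_add_eq_0 add.commute)

lemma scale_nat:
  assumes "x \<in> zk k"
  shows "M (\<lambda>i. int n * x i) = (\<lambda>i. int n * M x i)"
proof (induction n)
  case 0
  show ?case
    using zero by (simp add: zero_fun_def)
next
  case (Suc n)
  have "(\<lambda>i. int (Suc n) * x i) = (\<lambda>i. int n * x i) + x"
    by (simp add: fun_eq_iff algebra_simps)
  hence "M (\<lambda>i. int (Suc n) * x i) = M (\<lambda>i. int n * x i) + M x"
    using add assms by (simp add: zk_scale)
  thus ?case
    using Suc by (simp add: fun_eq_iff algebra_simps)
qed

lemma scale: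
  assumes "x \<in> zk k"
  shows "M (\<lambda>i. c * x i) = (\<lambda>i. c * M x i)"
proof (cases "c \<ge> 0")
  case True
  thus ?thesis
    using scale_nat[OF assms, of "nat c"] by simp
next
  case False
  hence neg: "M (\<lambda>i. - c * x i) = (\<lambda>i. - c * M x i)"
    using scale_nat[OF assms, of "nat (- c)"] by simp
  have "M (\<lambda>i. c * x i) = M (- (\<lambda>i. - c * x i))"
    by (rule arg_cong[of _ _ M]) (simp add: fun_eq_iff)
  also have "\<dots> = - (\<lambda>i. - c * M x i)"
    by (simp only: uminus[OF zk_scale[OF assms, of "- c"]] neg)
  finally show ?thesis
    by (simp add: fun_eq_iff)
qed

lemma expand_upto:
  assumes "n \<le> k" "z \<in> zk n"
  shows "M z i = (\<Sum>j<n. z j * M (single j 1) i)"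
  using assms
proof (induction n arbitrary: z)
  case 0
  hence "z = 0"
  by (auto simp: zk_def)
  show ?case
  unfolding \<open>z = 0\<close> zero by simp
next
  case (Suc n)
  define z' where "z' = z(n := 0)"
  have z': "z' \<in> zk n"
  using Suc.prems by (auto simp: zk_def z'_def)
  have z'k: "z' \<in> zk k"
  using z' Suc.prems(1) by (auto simp: zk_def)
  have s: "single n 1 \<in> zk k"
  using Suc.prems(1) by (intro single_in_zk) simp
  have "M z = M (z' + (\<lambda>i. z n * single n 1 i))"
  by (rule arg_cong[of _ _ M]) (auto simp: z'_def)
  also have "\<dots> = M z' + (\<lambda>i. z n * M (single n 1) i)"
  by (simp only: add[OF z'k zk_scale[OF s]] scale[OF s])
  finally have "M z i = M z' i + z n * M (single n 1) i"
  by simp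
  also have "M z' i = (\<Sum>j<n. z' j * M (single j 1) i)"
  using Suc.prems(1) by (intro Suc.IH z') simp
  also have "\<dots> = (\<Sum>j<n. z j * M (single j 1) i)"
  by (intro sum.cong) (auto simp: z'_def)
  finally show ?case
  by (simp only: sum.lessThan_Suc)
qed

section \<open>The real matrix of a lattice endomorphism and its eigenvalues\<close>

definition mat_of :: "real mat" where
  "mat_of = mat k k (\<lambda>(i, j). of_int (M (single j 1) i))"

lemma mat_of_carrier [simp]: "mat_of \<in> carrier_mat k k"
  by (simp add: mat_of_def)

text \<open>A matrix and its transpose have the same characteristic polynomial. An eigenvector
  \<open>w\<close> of the transpose, read as a linear functional, is multiplied by \<open>r\<close>
  under \<open>M\<close>.\<close>

lemma functional_of_root:
  assumes "poly (char_poly mat_of) r = 0"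
  obtains w :: "nat \<Rightarrow> real" and i where "i < k" "w i \<noteq> 0"
  "\<And>z. z \<in> zk k \<Longrightarrow> (\<Sum>j<k. w j * of_int (M z j)) = r * (\<Sum>j<k. w j * of_int (z j))"
proof -
  have "poly (char_poly (transpose_mat mat_of)) r = 0"
  using assms char_poly_transpose_mat[OF mat_of_carrier] by simp
  hence "eigenvalue (transpose_mat mat_of) r"
  by (subst eigenvalue_root_char_poly[of _ k]) simp_all
  then obtain v where v: "v \<in> carrier_vec k" "v \<noteq> 0\<^sub>v k"
  "transpose_mat mat_of *\<^sub>v v = r \<cdot>\<^sub>v v"
  unfolding eigenvalue_def eigenvector_def by (auto simp: mat_of_def)
  from v(1,2) obtain i where i: "i < k" "v $ i \<noteq> 0"
  by (metis carrier_vecD eq_vecI index_zero_vec)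
  have col: "(\<Sum>j<k. of_int (M (single l 1) j) * v $ j) = r * v $ l" if "l < k" for l
  proof -
  have "(transpose_mat mat_of *\<^sub>v v) $ l = (\<Sum>j<k. of_int (M (single l 1) j) * v $ j)"
    using that v(1) by (auto simp: mat_of_def scalar_prod_def lessThan_atLeast0 intro!: sum.cong)
  thus ?thesis
    using v that by simp
  qed
  have functional: "(\<Sum>j<k. v $ j * of_int (M z j)) = r * (\<Sum>j<k. v $ j * of_int (z j))"
  if z: "z \<in> zk k" for z
  proof -
  have "(\<Sum>j<k. v $ j * of_int (M z j))
      = (\<Sum>j<k. \<Sum>l<k. of_int (z l) * (of_int (M (single l 1) j) * v $ j))"
    by (simp add: expand_upto[OF order.refl z] sum_distrib_left mult_ac)
  also have "\<dots> = (\<Sum>l<k. \<Sum>j<k. of_int (z l) * (of_int (M (single l 1) j) * v $ j))"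
    by (rule sum.swap)
  also have "\<dots> = (\<Sum>l<k. of_int (z l) * (r * v $ l))"
    by (simp add: col flip: sum_distrib_left)
  finally show ?thesis
    by (simp add: sum_distrib_left mult_ac)
  qed
  show ?thesis
  by (rule that[where w = "\<lambda>j. v $ j", OF i functional])
qed

text \<open>A fixed vector is a right eigenvector for 1; passing through the characteristic
  polynomial makes \<open>functional_of_root\<close> available for \<open>r = 1\<close>.\<close>

lemma char_poly_fixed_point:
  assumes "y \<in> zk k" "y \<noteq> 0" "M y = y"
  shows "poly (char_poly mat_of) 1 = 0"
proof -
  define v :: "real vec" where "v = vec k (\<lambda>i. of_int (y i))"
  obtain i where "y i \<noteq> 0"
  using assms(2) by (auto simp: fun_eq_iff)
  moreover from this have "i < k"
  using assms(1) by (auto simp: zk_def not_le[symmetric])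
  ultimately have "v \<noteq> 0\<^sub>v k"
  by (auto simp: v_def vec_eq_iff)
  moreover have "mat_of *\<^sub>v v = v"
  proof (rule eq_vecI)
  fix i assume "i < dim_vec v"
  hence i: "i < k"
    by (simp add: v_def)
  have "of_int (y i) = (\<Sum>j<k. of_int (M (single j 1) i) * (of_int (y j) :: real))"
    using expand_upto[OF order.refl assms(1), of i] assms(3) by (simp add: mult_ac)
  thus "(mat_of *\<^sub>v v) $ i = v $ i"
    using i by (auto simp: mat_of_def v_def scalar_prod_def lessThan_atLeast0 intro!: sum.cong)
  qed (simp add: v_def mat_of_def)
  ultimately have "eigenvalue mat_of 1"
  unfolding eigenvalue_def eigenvector_def
  by (intro exI[of _ v]) (simp add: v_def mat_of_def)
  thus ?thesis
  by (simp add: eigenvalue_root_char_poly[OF mat_of_carrier])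
qed

lemma char_poly_root_odd:
  assumes "odd k"
  obtains r where "poly (char_poly mat_of) r = 0"
  using odd_degree_real_root[of "char_poly mat_of"] assms
  degree_monic_char_poly[OF mat_of_carrier] by auto

end

text \<open>The group of exponents has the unique product property: it is totally ordered by the
  lexicographic order, and the sum of the two largest elements of finite sets is attained once.\<close>

lemma less_fun_total:
  fixes f g :: "nat \<Rightarrow> int"
  shows "less_fun f g \<or> f = g \<or> less_fun g f"
proof (cases "f = g")
  case False
  hence ex: "\<exists>i. f i \<noteq> g i"
  by auto
  define i where "i = (LEAST i. f i \<noteq> g i)"
  have "f i \<noteq> g i" "\<And>j. j < i \<Longrightarrow> f j = g j"
  using LeastI_ex[OF ex] not_less_Least unfolding i_def by blast+
  thus ?thesis
  unfolding less_fun_def by (cases "f i < g i") (auto intro!: exI[of _ i])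
qed simp

lemma less_fun_add_mono:
  fixes f g h :: "nat \<Rightarrow> int"
  assumes "less_fun f g"
  shows "less_fun (f + h) (g + h)"
  using assms by (auto simp: less_fun_def)

lemma less_fun_max:
  fixes A :: "(nat \<Rightarrow> int) set"
  assumes "finite A" "A \<noteq> {}"
  shows "\<exists>m\<in>A. \<forall>x\<in>A. x = m \<or> less_fun x m"
  using assms
proof (induction rule: finite_ne_induct)
  case (insert a A)
  then obtain m where m: "m \<in> A" "\<forall>x\<in>A. x = m \<or> less_fun x m"
    by blast
  show ?case
  proof (cases "less_fun m a")
    case True
    hence "less_fun x a" if "x \<in> A" for x
      using m(2) that less_fun_trans[OF _ True] by auto
    thus ?thesis by blast
  next
    case False
    thus ?thesis using m less_fun_total[of a m] by auto
  qed
qed simp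

text \<open>Besides uniqueness, the maximality of \<open>p\<close> in \<open>P\<close> is recorded:
  applied to the negated sets as well, it allows the largest and the smallest element of
  \<open>P\<close> to be compared.\<close>

lemma unique_sum:
  fixes P Q :: "(nat \<Rightarrow> int) set"
  assumes "finite P" "P \<noteq> {}" "finite Q" "Q \<noteq> {}"
  shows "\<exists>p\<in>P. \<exists>q\<in>Q. (\<forall>x\<in>P. x = p \<or> less_fun x p) \<and>
    (\<forall>x\<in>P. \<forall>y\<in>Q. x + y = p + q \<longrightarrow> x = p \<and> y = q)"
proof -
  obtain p where p: "p \<in> P" "\<forall>x\<in>P. x = p \<or> less_fun x p"
    using less_fun_max[OF assms(1,2)] by blast
  obtain q where q: "q \<in> Q" "\<forall>x\<in>Q. x = q \<or> less_fun x q"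
    using less_fun_max[OF assms(3,4)] by blast
  have uniq: "x = p \<and> y = q" if xy: "x \<in> P" "y \<in> Q" and e: "x + y = p + q" for x y
  proof (rule ccontr)
    assume "\<not> (x = p \<and> y = q)"
    hence n: "x \<noteq> p" "y \<noteq> q"
      using e by auto
    have "less_fun (x + y) (p + y)"
      using n p(2) xy(1) by (auto intro: less_fun_add_mono)
    moreover have "less_fun (y + p) (q + p)"
      using n q(2) xy(2) by (auto intro: less_fun_add_mono)
    ultimately have "less_fun (x + y) (p + q)"
      unfolding add.commute[of y p] add.commute[of q p] by (rule less_fun_trans)
    thus False
      unfolding e by (rule notE[OF less_fun_irrefl])
  qed
  show ?thesis
    by (intro bexI[OF _ p(1)] bexI[OF _ q(1)] conjI[OF p(2)] ballI impI uniq)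
qed

section \<open>Wreath products and twisted conjugacy\<close>

lemma lamp_D:
  assumes "a \<in> lamp k"
  shows "a x \<in> {0,1,2}" "x \<notin> zk k \<Longrightarrow> a x = 0" "finite {x. a x \<noteq> 0}" "a x mod 3 = a x"
proof -
  show "a x \<in> {0,1,2}" using assms by (auto simp: lamp_def)
  thus "a x mod 3 = a x" by auto
qed (use assms in \<open>auto simp: lamp_def\<close>)

lemma lamp_mod: "a \<in> lamp k \<Longrightarrow> (\<lambda>x. a x mod 3) = a"
  by (rule ext) (rule lamp_D(4))

lemma mod3_in: "(n :: int) mod 3 \<in> {0,1,2}"
proof -
  have "n mod 3 = 0 \<or> n mod 3 = 1 \<or> n mod 3 = 2"
    by presburger
  thus ?thesis by blast
qed

lemma lamp_modI:
  assumes "\<And>x. x \<notin> zk k \<Longrightarrow> f x mod 3 = 0" "finite {x. f x mod 3 \<noteq> 0}"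
  shows "(\<lambda>x. f x mod 3) \<in> lamp k"
  using assms mod3_in unfolding lamp_def by blast

lemma lamp_zero [simp]: "0 \<in> lamp k"
  by (simp add: lamp_def)

lemma lamp_single: "x \<in> zk k \<Longrightarrow> c \<in> {0,1,2} \<Longrightarrow> single x c \<in> lamp k"
  by (auto simp: lamp_def)

text \<open>One closure property from which sums, negatives, translates, products and inverses
  follow by choosing \<open>a\<close>, \<open>y\<close> and \<open>c\<close>.\<close>

lemma lamp_combine:
  assumes a: "a \<in> lamp k" and b: "b \<in> lamp k" and y: "y \<in> zk k"
  shows "(\<lambda>x. (a x + c * b (x - y)) mod 3) \<in> lamp k"
proof (rule lamp_modI)
  fix x assume x: "x \<notin> zk k"
  hence "x - y \<notin> zk k"
    using zk_add[of "x - y" k y] y by auto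
  thus "(a x + c * b (x - y)) mod 3 = 0"
    using x a b by (simp add: lamp_D)
next
  have "{x. (a x + c * b (x - y)) mod 3 \<noteq> 0} \<subseteq> {x. a x \<noteq> 0} \<union> (\<lambda>x. x + y) ` {x. b x \<noteq> 0}"
  proof
    fix x assume x: "x \<in> {x. (a x + c * b (x - y)) mod 3 \<noteq> 0}"
    show "x \<in> {x. a x \<noteq> 0} \<union> (\<lambda>x. x + y) ` {x. b x \<noteq> 0}"
    proof (cases "b (x - y) = 0")
      case False
      have "x = (x - y) + y" by simp
      with False show ?thesis by blast
    qed (use x in auto)
  qed
  thus "finite {x. (a x + c * b (x - y)) mod 3 \<noteq> 0}"
    using lamp_D(3)[OF a] lamp_D(3)[OF b] finite_subset by blast
qed

lemma lamp_add: "a \<in> lamp k \<Longrightarrow> b \<in> lamp k \<Longrightarrow> (\<lambda>x. (a x + b x) mod 3) \<in> lamp k"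
  using lamp_combine[of a k b 0 1] by simp

lemma lamp_neg: "a \<in> lamp k \<Longrightarrow> (\<lambda>x. (- a x) mod 3) \<in> lamp k"
  using lamp_combine[of 0 k a 0 "-1"] by simp

lemma lamp_shift: "a \<in> lamp k \<Longrightarrow> y \<in> zk k \<Longrightarrow> (\<lambda>x. a (x - y)) \<in> lamp k"
  using lamp_combine[of 0 k a y 1] by (simp add: lamp_D(4))

lemma wreath_carrier: "carrier (wreath k) = lamp k \<times> zk k"
  and wreath_one: "\<one>\<^bsub>wreath k\<^esub> = (0, 0)"
  and wreath_mult: "(a, y) \<otimes>\<^bsub>wreath k\<^esub> (b, z) = ((\<lambda>x. (a x + b (x - y)) mod 3), y + z)"
  by (simp_all add: wreath_def zero_fun_def plus_fun_def fun_diff_def)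

lemma wreath_left_inverse:
  assumes "a \<in> lamp k" "y \<in> zk k"
  shows "((\<lambda>x. (- a (x + y)) mod 3), - y) \<otimes>\<^bsub>wreath k\<^esub> (a, y) = (0, 0)"
  by (auto simp: wreath_mult fun_eq_iff mod_simps)

lemma wreath_inverse_closed:
  assumes "a \<in> lamp k" "y \<in> zk k"
  shows "((\<lambda>x. (- a (x + y)) mod 3), - y) \<in> carrier (wreath k)"
  using lamp_combine[of 0 k a "- y" "-1"] assms by (auto simp: wreath_carrier zk_uminus)

lemma group_wreath: "group (wreath k)"
proof (rule groupI)
  fix g h assume "g \<in> carrier (wreath k)" "h \<in> carrier (wreath k)"
  thus "g \<otimes>\<^bsub>wreath k\<^esub> h \<in> carrier (wreath k)"
    using lamp_combine[of _ k _ _ 1] by (auto simp: wreath_carrier wreath_mult zk_add)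
next
  show "\<one>\<^bsub>wreath k\<^esub> \<in> carrier (wreath k)"
    by (simp add: wreath_carrier wreath_one)
next
  fix f g h
  show "f \<otimes>\<^bsub>wreath k\<^esub> g \<otimes>\<^bsub>wreath k\<^esub> h = f \<otimes>\<^bsub>wreath k\<^esub> (g \<otimes>\<^bsub>wreath k\<^esub> h)"
    by (cases f; cases g; cases h) (simp add: wreath_mult mod_simps add.assoc diff_diff_eq)
next
  fix g assume "g \<in> carrier (wreath k)"
  thus "\<one>\<^bsub>wreath k\<^esub> \<otimes>\<^bsub>wreath k\<^esub> g = g"
    by (cases g) (auto simp: wreath_carrier wreath_one wreath_mult lamp_D fun_eq_iff)
next
  fix g assume "g \<in> carrier (wreath k)"
  then obtain a y where g: "g = (a, y)" "a \<in> lamp k" "y \<in> zk k"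
    by (auto simp: wreath_carrier)
  show "\<exists>h\<in>carrier (wreath k). h \<otimes>\<^bsub>wreath k\<^esub> g = \<one>\<^bsub>wreath k\<^esub>"
    unfolding g(1) wreath_one
    using wreath_left_inverse[OF g(2,3)] wreath_inverse_closed[OF g(2,3)] by (rule bexI)
qed

lemma wreath_inv:
  assumes "a \<in> lamp k" "y \<in> zk k"
  shows "inv\<^bsub>wreath k\<^esub> (a, y) = ((\<lambda>x. (- a (x + y)) mod 3), - y)"
  by (rule group.inv_equality[OF group_wreath])
     (use assms wreath_left_inverse wreath_inverse_closed in \<open>auto simp: wreath_carrier wreath_one\<close>)

section \<open>Twisted conjugacy classes in an arbitrary group\<close>

lemma twisted_conjI:
  fixes G (structure)
  assumes "g \<in> carrier G" "g' \<in> carrier G" "h \<in> carrier G" "g' = h \<otimes> g \<otimes> \<phi> (inv h)"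
  shows "(g, g') \<in> twisted_conj G \<phi>"
  using assms unfolding twisted_conj_def by blast

lemma twisted_conj_refl:
  fixes G (structure)
  assumes "group G" "\<phi> \<in> hom G G" "g \<in> carrier G"
  shows "(g, g) \<in> twisted_conj G \<phi>"
proof -
  interpret group G by fact
  have "\<phi> (inv \<one>) = \<one>"
    using hom_one[OF assms(2)] assms(1) by simp
  hence "g = \<one> \<otimes> g \<otimes> \<phi> (inv \<one>)"
    using assms(3) by simp
  thus ?thesis
    using assms(3) by (intro twisted_conjI[of _ _ _ \<one>]) simp_all
qed

lemma equiv_twisted_conj:
  fixes G (structure)
  assumes "group G" "\<phi> \<in> hom G G"
  shows "equiv (carrier G) (twisted_conj G \<phi>)"
proof -
  interpret group G by fact
  interpret f: group_hom G G \<phi>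
    using assms by (simp add: group_hom_def group_hom_axioms_def)
  show ?thesis
  proof (rule equivI)
    show "twisted_conj G \<phi> \<subseteq> carrier G \<times> carrier G"
      by (auto simp: twisted_conj_def)
    show "refl_on (carrier G) (twisted_conj G \<phi>)"
      using twisted_conj_refl[OF assms] by (auto simp: refl_on_def)
    show "sym (twisted_conj G \<phi>)"
    proof (rule symI)
      fix g g' assume "(g, g') \<in> twisted_conj G \<phi>"
      then obtain h where h: "g \<in> carrier G" "h \<in> carrier G" "g' = h \<otimes> g \<otimes> \<phi> (inv h)"
        by (auto simp: twisted_conj_def)
      have "inv h \<otimes> g' \<otimes> \<phi> h = (inv h \<otimes> h) \<otimes> g \<otimes> (\<phi> (inv h) \<otimes> \<phi> h)"
        using h by (simp only: m_assoc m_closed f.hom_closed inv_closed)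
      also have "\<phi> (inv h) \<otimes> \<phi> h = \<one>"
        using h by simp
      finally have "g = inv h \<otimes> g' \<otimes> \<phi> (inv (inv h))"
        using h by simp
      thus "(g', g) \<in> twisted_conj G \<phi>"
        using h by (intro twisted_conjI[of _ _ _ "inv h"]) simp_all
    qed
    show "trans (twisted_conj G \<phi>)"
    proof (rule transI)
      fix g1 g2 g3 assume "(g1, g2) \<in> twisted_conj G \<phi>" "(g2, g3) \<in> twisted_conj G \<phi>"
      then obtain h h' where h: "g1 \<in> carrier G" "h \<in> carrier G" "h' \<in> carrier G"
        "g2 = h \<otimes> g1 \<otimes> \<phi> (inv h)" "g3 = h' \<otimes> g2 \<otimes> \<phi> (inv h')"
        by (auto simp: twisted_conj_def)
      hence "g3 = (h' \<otimes> h) \<otimes> g1 \<otimes> \<phi> (inv (h' \<otimes> h))"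
        by (simp add: m_assoc inv_mult_group del: f.hom_inv)
      thus "(g1, g3) \<in> twisted_conj G \<phi>"
        using h by (intro twisted_conjI[of _ _ _ "h' \<otimes> h"]) simp_all
    qed
  qed
qed

lemma infinite_reidemeister_classesI:
  fixes f :: "nat \<Rightarrow> 'a"
  assumes "group G" "\<phi> \<in> hom G G" "\<And>n. f n \<in> carrier G"
    and "\<And>m n. (f m, f n) \<in> twisted_conj G \<phi> \<Longrightarrow> m = n"
  shows "infinite (reidemeister_classes G \<phi>)"
proof -
  have "inj (\<lambda>n. twisted_conj G \<phi> `` {f n})"
  proof (rule injI)
    fix m n assume "twisted_conj G \<phi> `` {f m} = twisted_conj G \<phi> `` {f n}"
    thus "m = n"
      by (rule assms(4)[OF eq_equiv_class[OF _ equiv_twisted_conj[OF assms(1,2)] assms(3)]])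
  qed
  moreover have "range (\<lambda>n. twisted_conj G \<phi> `` {f n}) \<subseteq> reidemeister_classes G \<phi>"
    using assms(3) by (auto simp: reidemeister_classes_def quotient_def)
  ultimately show ?thesis
    using finite_subset range_inj_infinite by blast
qed

lemma finite_reidemeister_classesI:
  assumes "group G" "\<phi> \<in> hom G G" "finite B" "\<And>g. g \<in> carrier G \<Longrightarrow> \<exists>b\<in>B. (g, b) \<in> twisted_conj G \<phi>"
  shows "finite (reidemeister_classes G \<phi>)"
proof (rule finite_subset)
  show "reidemeister_classes G \<phi> \<subseteq> (\<lambda>b. twisted_conj G \<phi> `` {b}) ` B"
  proof
    fix X assume "X \<in> reidemeister_classes G \<phi>"
    then obtain g where g: "g \<in> carrier G" "X = twisted_conj G \<phi> `` {g}"
      by (auto simp: reidemeister_classes_def elim: quotientE)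
    then obtain b where b: "b \<in> B" "(g, b) \<in> twisted_conj G \<phi>"
      using assms(4) by blast
    show "X \<in> (\<lambda>b. twisted_conj G \<phi> `` {b}) ` B"
      using equiv_class_eq[OF equiv_twisted_conj[OF assms(1,2)] b(2)] g(2) b(1)
      by (intro image_eqI[of _ _ b]) simp_all
  qed
qed (use assms(3) in simp)

section \<open>Even rank\<close>

text \<open>The block matrix with blocks \<open>((0, -1), (1, -1))\<close> of order 3 on the coordinates \<open>2j, 2j+1\<close>.\<close>

definition rot :: "(nat \<Rightarrow> int) \<Rightarrow> nat \<Rightarrow> int" where
  "rot y i = (if even i then - y (i + 1) else y (i - 1) - y i)"

lemma rot_add: "rot (x + y) = rot x + rot y"
  and rot_diff: "rot (x - y) = rot x - rot y"
  and rot_zero: "rot 0 = 0"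
  and rot_uminus: "rot (- y) = - rot y"
  by (auto simp: rot_def fun_eq_iff)

text \<open>The relation on which the even case rests: it cancels the translation part in the third
  power of a translated rotation, and it yields the factorization of 3 by
  \<open>1 - M\<close>.\<close>

lemma rot_sum: "y + rot y + rot (rot y) = 0"
  by (auto simp: rot_def fun_eq_iff)

lemma rot_rot_rot: "rot (rot (rot y)) = y"
  by (auto simp: rot_def fun_eq_iff)

lemma rot_in_zk:
  assumes "even k" "y \<in> zk k"
  shows "rot y \<in> zk k"
proof -
  \<comment> \<open>For even \<open>k\<close> no block of coordinates \<open>2j\<close>,
    \<open>2j+1\<close> straddles the bound \<open>k\<close>: an odd \<open>i \<ge> k\<close> cannot
    equal \<open>k\<close>.\<close>
  have "i - 1 \<ge> k" if "odd i" "i \<ge> k" for i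
    using that assms(1) by (cases "i = k") auto
  thus ?thesis
    using assms(2) by (auto simp: zk_def rot_def)
qed

lemma rot_in_zk_iff: "even k \<Longrightarrow> rot y \<in> zk k \<longleftrightarrow> y \<in> zk k"
  using rot_in_zk rot_rot_rot by metis

lemma lamp_compose:
  assumes "a \<in> lamp k" "\<And>x. f x \<in> zk k \<Longrightarrow> x \<in> zk k" "inj f"
  shows "(\<lambda>x. a (f x)) \<in> lamp k"
proof -
  have "finite (f -` {x. a x \<noteq> 0})"
    using assms(1,3) by (intro finite_vimageI lamp_D(3))
  moreover have "f -` {x. a x \<noteq> 0} = {x. a (f x) \<noteq> 0}"
    by auto
  ultimately show ?thesis
    using lamp_D(1)[OF assms(1)] lamp_D(2)[OF assms(1)] assms(2) by (simp only: lamp_def mem_Collect_eq) blast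
qed

lemma inj_rot: "inj rot"
  by (rule inj_on_inverseI[of _ "\<lambda>x. rot (rot x)"]) (rule rot_rot_rot)

text \<open>Since \<open>rot\<close> composed with itself is the inverse of \<open>rot\<close>, the
  generator at \<open>x\<close> is sent to minus the generator at \<open>rot x\<close>.\<close>

definition twist :: "((nat \<Rightarrow> int) \<Rightarrow> int) \<times> (nat \<Rightarrow> int) \<Rightarrow> ((nat \<Rightarrow> int) \<Rightarrow> int) \<times> (nat \<Rightarrow> int)" where
  "twist = (\<lambda>(a, y). ((\<lambda>x. (- a (rot (rot x))) mod 3), rot y))"

lemma twist_closed:
  assumes "even k" "g \<in> carrier (wreath k)"
  shows "twist g \<in> carrier (wreath k)"
proof -
  obtain a y where g: "g = (a, y)" "a \<in> lamp k" "y \<in> zk k"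
    using assms(2) by (auto simp: wreath_carrier)
  have inj: "inj (\<lambda>x. rot (rot x))"
    using inj_compose[OF inj_rot inj_rot] by (simp add: comp_def)
  have "(\<lambda>x. a (rot (rot x))) \<in> lamp k"
    using assms(1) by (intro lamp_compose[OF g(2) _ inj]) (simp add: rot_in_zk_iff)
  from lamp_neg[OF this] show ?thesis
    using assms(1) g by (simp add: twist_def wreath_carrier rot_in_zk)
qed

lemma twist_hom: 
  assumes "even k"
  shows "twist \<in> hom (wreath k) (wreath k)"
proof (rule homI)
  fix g h assume "g \<in> carrier (wreath k)" "h \<in> carrier (wreath k)"
  show "twist (g \<otimes>\<^bsub>wreath k\<^esub> h) = twist g \<otimes>\<^bsub>wreath k\<^esub> twist h"
    by (cases g; cases h) (simp add: twist_def wreath_mult rot_add rot_diff rot_rot_rot mod_simps)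
qed (use assms twist_closed in auto)

text \<open>The rotation has order 3 and the sign has order 2, so the fifth power of
  \<open>twist\<close> can serve as its inverse.\<close>

lemma twist_six:
  assumes "g \<in> carrier (wreath k)"
  shows "twist (twist (twist (twist (twist (twist g))))) = g"
  using assms by (cases g) (auto simp: twist_def rot_rot_rot mod_simps wreath_carrier lamp_mod)

lemma twist_iso:
  assumes "even k"
  shows "twist \<in> iso (wreath k) (wreath k)"
proof -
  have "bij_betw twist (carrier (wreath k)) (carrier (wreath k))"
    by (rule bij_betw_byWitness[where f' = "\<lambda>g. twist (twist (twist (twist (twist g))))"])
       (use assms in \<open>auto simp: twist_six twist_closed\<close>)
  thus ?thesis
    using twist_hom[OF assms] by (simp add: iso_def)
qed

text \<open>The twisted translation \<open>a \<mapsto> a \<circ> S\<close> satisfies \<open>S\<^sup>3 = 1\<close>, and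
  \<open>(1 + S) (1 - S + S\<^sup>2) = 2\<close> is invertible modulo 3.\<close>

lemma twist_kill_lamp:
  assumes k: "even k" and a: "a \<in> lamp k" and y: "y \<in> zk k"
  shows "((a, y), (0, y)) \<in> twisted_conj (wreath k) twist"
proof -
  define S where "S x = rot (rot (x - y))" for x
  have S3: "S (S (S x)) = x" for x
  proof -
    have "S (S (S x)) = x - (y + rot y + rot (rot y))"
      by (simp only: S_def rot_diff rot_rot_rot rot_add diff_diff_eq add_ac)
    thus ?thesis
      by (simp add: rot_sum)
  qed
  have S_inj: "inj S"
    by (rule inj_on_inverseI[of _ "\<lambda>x. S (S x)"]) (rule S3)
  have Szk: "x \<in> zk k" if "S x \<in> zk k" for x
    using that k zk_add[of "x - y" k y] y by (simp add: S_def rot_in_zk_iff)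
  have aS: "(\<lambda>x. a (S x)) \<in> lamp k"
    by (rule lamp_compose[OF a Szk S_inj])
  have aSS: "(\<lambda>x. a (S (S x))) \<in> lamp k"
    by (rule lamp_compose[OF aS Szk S_inj])
  \<comment> \<open>This is \<open>(1 - S + S^2) a\<close>; applying \<open>1 + S\<close> gives
    \<open>2 a\<close>, which is \<open>- a\<close> modulo 3. So \<open>b\<close> is the conjugator
    that removes \<open>a\<close>: the signs from the inverse and from \<open>twist\<close>
    cancel.\<close>
  define b where "b x = (a x - a (S x) + a (S (S x))) mod 3" for x
  have "(\<lambda>x. (a x + - 1 * a (S x)) mod 3) \<in> lamp k"
    using lamp_combine[OF a aS, of 0 "- 1"] by simp
  from lamp_add[OF this aSS] have b: "b \<in> lamp k"
    by (simp add: b_def[abs_def] mod_simps)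
  have eq: "(a x + b x + b (S x)) mod 3 = 0" for x
    unfolding b_def S3 by presburger
  have "(b x + a x - - b (rot (rot (x - y)))) mod 3 = 0" for x
    using eq[of x] by (simp add: S_def add.commute)
  hence "(0, y) = (b, 0) \<otimes>\<^bsub>wreath k\<^esub> (a, y) \<otimes>\<^bsub>wreath k\<^esub> twist (inv\<^bsub>wreath k\<^esub> (b, 0))"
    by (simp add: wreath_inv b wreath_mult twist_def rot_zero mod_simps) (simp add: fun_eq_iff)
  thus ?thesis
    by (rule twisted_conjI[rotated 3]) (use a b y in \<open>simp_all add: wreath_carrier\<close>)
qed

text \<open>Uses \<open>(1 - M) (2 + M) = 3\<close>.\<close>

lemma twist_reduce_mod_3:
  assumes k: "even k" and y: "y \<in> zk k"
  shows "((0, y), (0, \<lambda>i. y i mod 3)) \<in> twisted_conj (wreath k) twist"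
proof -
  define q where "q = (\<lambda>i. y i div 3)"
  have q: "q \<in> zk k"
    using y by (simp add: q_def zk_def)
  \<comment> \<open>Here \<open>z = - (2 + M) q\<close>, so conjugation by \<open>(0, z)\<close>
    adds \<open>(1 - M) z = - 3 q\<close> to the exponent.\<close>
  define z where "z = - (q + q + rot q)"
  have z: "z \<in> zk k"
    unfolding z_def by (intro zk_uminus zk_add rot_in_zk k q)
  have m: "(\<lambda>i. y i mod 3) \<in> zk k"
    using y by (simp add: zk_def)
  have "y i mod 3 = y i - (q i + q i + q i)" for i
    unfolding q_def by presburger
  moreover have "(z - rot z) i = - (q i + q i + q i)" for i
    by (simp add: z_def rot_def)
  ultimately have "(\<lambda>i. y i mod 3) = z + y - rot z"
    by (simp add: fun_eq_iff)
  hence "(0, \<lambda>i. y i mod 3) = (0, z) \<otimes>\<^bsub>wreath k\<^esub> (0, y) \<otimes>\<^bsub>wreath k\<^esub> twist (inv\<^bsub>wreath k\<^esub> (0, z))"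
    by (simp add: wreath_inv z wreath_mult twist_def rot_uminus fun_eq_iff)
  thus ?thesis
    by (rule twisted_conjI[rotated 3]) (use y z m in \<open>simp_all add: wreath_carrier\<close>)
qed

lemma not_R_infty_even:
  assumes "even k"
  shows "\<not> R_infty (wreath k)"
proof -
  define B :: "(((nat \<Rightarrow> int) \<Rightarrow> int) \<times> (nat \<Rightarrow> int)) set" where
    "B = {0} \<times> {y. \<forall>i. (i \<in> {..<k} \<longrightarrow> y i \<in> {0..2}) \<and> (i \<notin> {..<k} \<longrightarrow> y i = 0)}"
  have B: "finite B"
    unfolding B_def by (intro finite_cartesian_product finite_set_of_finite_funs) simp_all
  have trans: "trans (twisted_conj (wreath k) twist)"
    using equiv_twisted_conj[OF group_wreath twist_hom[OF assms]] by (rule equivE)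
  have red: "\<exists>b\<in>B. (g, b) \<in> twisted_conj (wreath k) twist" if g_in: "g \<in> carrier (wreath k)" for g
  proof -
    obtain a y where g: "g = (a, y)" "a \<in> lamp k" "y \<in> zk k"
      using g_in by (auto simp: wreath_carrier)
    have "(g, (0, \<lambda>i. y i mod 3)) \<in> twisted_conj (wreath k) twist"
      unfolding g(1)
      by (rule transD[OF trans twist_kill_lamp[OF assms g(2,3)] twist_reduce_mod_3[OF assms g(3)]])
    moreover have "(0, \<lambda>i. y i mod 3) \<in> B"
      using g(3) by (auto simp: B_def zk_def)
    ultimately show ?thesis
      by (rule bexI)
  qed
  have "finite (reidemeister_classes (wreath k) twist)"
    by (rule finite_reidemeister_classesI[OF group_wreath twist_hom[OF assms] B red])
  thus ?thesis
    using twist_iso[OF assms] unfolding R_infty_def by blast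
qed

section \<open>Endomorphisms of the wreath product\<close>

locale wreath_hom =
  fixes k :: nat and \<phi> :: "((nat \<Rightarrow> int) \<Rightarrow> int) \<times> (nat \<Rightarrow> int) \<Rightarrow> ((nat \<Rightarrow> int) \<Rightarrow> int) \<times> (nat \<Rightarrow> int)"
  assumes hom: "\<phi> \<in> hom (wreath k) (wreath k)"
begin

definition F :: "((nat \<Rightarrow> int) \<Rightarrow> int) \<Rightarrow> (nat \<Rightarrow> int) \<Rightarrow> int" where
  "F a = fst (\<phi> (a, 0))"

text \<open>The map induced on the quotient by the base group, computed on the lift
  \<open>(0, y)\<close>; \<open>snd_phi\<close> shows that any other lift gives the same
  result.\<close>

definition M :: "(nat \<Rightarrow> int) \<Rightarrow> nat \<Rightarrow> int" where
  "M y = snd (\<phi> (0, y))"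

lemma phi_mult:
  "a \<in> lamp k \<Longrightarrow> y \<in> zk k \<Longrightarrow> b \<in> lamp k \<Longrightarrow> z \<in> zk k \<Longrightarrow>
    \<phi> ((a, y) \<otimes>\<^bsub>wreath k\<^esub> (b, z)) = \<phi> (a, y) \<otimes>\<^bsub>wreath k\<^esub> \<phi> (b, z)"
  using hom_mult[OF hom] by (simp add: wreath_carrier)

lemma phi_one: "\<phi> (0, 0) = (0, 0)"
  using hom_one[OF hom group_wreath group_wreath] by (simp add: wreath_one)

lemma phi_closed:
  assumes "a \<in> lamp k" "y \<in> zk k"
  shows "fst (\<phi> (a, y)) \<in> lamp k" "snd (\<phi> (a, y)) \<in> zk k"
  using hom_in_carrier[OF hom, of "(a, y)"] assms by (auto simp: wreath_carrier mem_Times_iff)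

lemma F_closed: "a \<in> lamp k \<Longrightarrow> F a \<in> lamp k"
  unfolding F_def by (rule phi_closed) simp_all

text \<open>The base group consists of the elements of order dividing 3, so it is preserved.\<close>

lemma phi_lamp:
  assumes "a \<in> lamp k"
  shows "\<phi> (a, 0) = (F a, 0)"
proof -
  obtain b y where eq: "\<phi> (a, 0) = (b, y)"
    by (cases "\<phi> (a, 0)")
  define s where "s = (\<lambda>x. (a x + a x) mod 3)"
  have s: "s \<in> lamp k" "(a, 0) \<otimes>\<^bsub>wreath k\<^esub> (a, 0) = (s, 0)"
    using lamp_add[OF assms assms] by (simp_all add: s_def wreath_mult)
  have "(s, 0) \<otimes>\<^bsub>wreath k\<^esub> (a, 0) = (0, 0)"
    by (simp add: s_def wreath_mult mod_simps) (simp add: fun_eq_iff)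
  hence "\<phi> (a, 0) \<otimes>\<^bsub>wreath k\<^esub> \<phi> (a, 0) \<otimes>\<^bsub>wreath k\<^esub> \<phi> (a, 0) = (0, 0)"
    using phi_mult[of a 0 a 0] phi_mult[of s 0 a 0] assms s phi_one by simp
  hence "(b, y) \<otimes>\<^bsub>wreath k\<^esub> (b, y) \<otimes>\<^bsub>wreath k\<^esub> (b, y) = (0, 0)"
    using eq by simp
  hence "y + y + y = 0"
    by (simp add: wreath_mult)
  hence "y i + y i + y i = 0" for i
    by (metis plus_fun_apply zero_fun_apply)
  hence "y = 0"
    by (simp add: fun_eq_iff)
  thus ?thesis
    using eq by (simp add: F_def)
qed

lemma snd_phi:
  assumes "a \<in> lamp k" "y \<in> zk k"
  shows "snd (\<phi> (a, y)) = M y"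
proof -
  have "(a, y) = (a, 0) \<otimes>\<^bsub>wreath k\<^esub> (0, y)"
    using assms by (simp add: wreath_mult lamp_mod)
  hence "\<phi> (a, y) = (F a, 0) \<otimes>\<^bsub>wreath k\<^esub> \<phi> (0, y)"
    using assms by (simp add: phi_mult phi_lamp)
  thus ?thesis
    by (cases "\<phi> (0, y)") (simp add: wreath_mult M_def)
qed

sublocale top: zk_endo k M
proof
  fix x y assume xy: "x \<in> zk k" "y \<in> zk k"
  have "(0, x + y) = (0, x) \<otimes>\<^bsub>wreath k\<^esub> (0, y)"
    by (simp add: wreath_mult) (simp add: fun_eq_iff)
  hence "\<phi> (0, x + y) = \<phi> (0, x) \<otimes>\<^bsub>wreath k\<^esub> \<phi> (0, y)"
    using xy by (simp add: phi_mult)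
  thus "M (x + y) = M x + M y"
    by (cases "\<phi> (0, x)"; cases "\<phi> (0, y)") (simp add: wreath_mult M_def)
qed (simp add: M_def phi_closed)

lemma F_add:
  assumes "a \<in> lamp k" "b \<in> lamp k"
  shows "F (\<lambda>x. (a x + b x) mod 3) = (\<lambda>x. (F a x + F b x) mod 3)"
proof -
  have "((\<lambda>x. (a x + b x) mod 3), 0) = (a, 0) \<otimes>\<^bsub>wreath k\<^esub> (b, 0)"
    by (simp add: wreath_mult)
  hence "\<phi> ((\<lambda>x. (a x + b x) mod 3), 0) = (F a, 0) \<otimes>\<^bsub>wreath k\<^esub> (F b, 0)"
    using assms by (simp add: phi_mult phi_lamp)
  thus ?thesis
    by (simp add: F_def wreath_mult)
qed

lemma F_zero: "F 0 = 0"
  by (simp add: F_def phi_one)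

text \<open>Translation by \<open>m\<close> is conjugation by \<open>(0, m)\<close>, written without
  inverses as a commutation relation. The base part \<open>c\<close> of the image of
  \<open>(0, m)\<close> cancels because the base group is commutative.\<close>

lemma F_shift:
  assumes a: "a \<in> lamp k" and m: "m \<in> zk k"
  shows "F (\<lambda>x. a (x - m)) = (\<lambda>x. F a (x - M m))"
proof -
  define a' where "a' = (\<lambda>x. a (x - m))"
  have a': "a' \<in> lamp k"
    unfolding a'_def using a m by (rule lamp_shift)
  obtain c where c: "\<phi> (0, m) = (c, M m)"
    by (cases "\<phi> (0, m)") (simp add: M_def)
  have "(0, m) \<otimes>\<^bsub>wreath k\<^esub> (a, 0) = (a', 0) \<otimes>\<^bsub>wreath k\<^esub> (0, m)"
    by (simp add: wreath_mult a'_def)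
  hence "(c, M m) \<otimes>\<^bsub>wreath k\<^esub> (F a, 0) = (F a', 0) \<otimes>\<^bsub>wreath k\<^esub> (c, M m)"
    using a a' m c phi_mult[of 0 m a 0] phi_mult[of a' 0 0 m] by (simp add: phi_lamp)
  hence "(\<lambda>x. (c x + F a (x - M m)) mod 3) = (\<lambda>x. (F a' x + c x) mod 3)"
    by (simp add: wreath_mult)
  hence eq: "(c x + F a (x - M m)) mod 3 = (F a' x + c x) mod 3" for x
    by (rule fun_cong)
  have cancel: "g mod 3 = f mod 3" if "(d + f) mod 3 = (g + d) mod 3" for d f g :: int
  proof -
    have "((d + f) - d) mod 3 = ((g + d) - d) mod 3"
      using that by (rule mod_diff_cong) simp
    thus ?thesis by simp
  qed
  have "F a' x = F a (x - M m)" for x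
    using cancel[OF eq[of x]] lamp_D(4)[OF F_closed[OF a]] lamp_D(4)[OF F_closed[OF a']] by metis
  thus ?thesis
    unfolding a'_def by (rule ext)
qed

lemma F_single:
  assumes m: "m \<in> zk k" and c: "c \<in> {0,1,2}"
  shows "F (single m c) x mod 3 = (c * F (single 0 1) (x - M m)) mod 3"
proof -
  have "single m 1 = (\<lambda>x. single 0 1 (x - m))"
    by (simp add: single_def fun_upd_def)
  hence one: "F (single m 1) = (\<lambda>x. F (single 0 1) (x - M m))"
    using F_shift[OF _ m, of "single 0 1"] by (simp only: lamp_single zk_zero insert_iff simp_thms)
  have "single m 2 = (\<lambda>x. (single m 1 x + single m 1 x) mod 3)"
    by (simp add: fun_eq_iff)
  hence two: "F (single m 2) = (\<lambda>x. (F (single m 1) x + F (single m 1) x) mod 3)"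
    using F_add[of "single m 1" "single m 1"] m by (simp only: lamp_single insert_iff simp_thms)
  have "single m 0 = 0"
    by (simp add: fun_eq_iff)
  with c one two F_zero show ?thesis
    by (auto simp: mod_simps)
qed

text \<open>In group ring terms, \<open>F a\<close> is the image of \<open>a\<close> under
  \<open>M\<close> times the image of the generator at 0. Any finite \<open>A\<close> containing the
  support is allowed, which suits the induction and lets later uses add a point.\<close>

lemma F_expand:
  assumes "finite A" "A \<subseteq> zk k" "a \<in> lamp k" "{x. a x \<noteq> 0} \<subseteq> A"
  shows "F a x mod 3 = (\<Sum>m\<in>A. a m * F (single 0 1) (x - M m)) mod 3"
  using assms
proof (induction A arbitrary: a rule: finite_induct)
  case empty
  hence "a = 0"
    by (auto simp: fun_eq_iff)
  show ?case
    unfolding \<open>a = 0\<close> F_zero by simp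
next
  case (insert m A)
  define a' where "a' = a(m := 0)"
  have m: "m \<in> zk k" and c: "a m \<in> {0,1,2}"
    using insert.prems(1) lamp_D(1)[OF insert.prems(2)] by simp_all
  have a': "a' \<in> lamp k"
  proof -
    have "{x. a' x \<noteq> 0} \<subseteq> {x. a x \<noteq> 0}"
      by (auto simp: a'_def)
    hence "finite {x. a' x \<noteq> 0}"
      using lamp_D(3)[OF insert.prems(2)] by (rule finite_subset)
    thus ?thesis
      using insert.prems(2) by (simp add: lamp_def a'_def)
  qed
  have "a = (\<lambda>x. (a' x + single m (a m) x) mod 3)"
    using lamp_D(4)[OF insert.prems(2)] by (intro ext) (simp add: a'_def)
  hence "F a = F (\<lambda>x. (a' x + single m (a m) x) mod 3)"
    by (rule arg_cong)
  also have "\<dots> = (\<lambda>x. (F a' x + F (single m (a m)) x) mod 3)"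
    by (rule F_add[OF a' lamp_single[OF m c]])
  finally have "F a x mod 3 = (F a' x mod 3 + F (single m (a m)) x mod 3) mod 3"
    by (simp add: mod_simps)
  also have "F a' x mod 3 = (\<Sum>l\<in>A. a' l * F (single 0 1) (x - M l)) mod 3"
    using insert.prems by (intro insert.IH a') (auto simp: a'_def)
  also have "(\<Sum>l\<in>A. a' l * F (single 0 1) (x - M l)) = (\<Sum>l\<in>A. a l * F (single 0 1) (x - M l))"
    using insert.hyps by (intro sum.cong) (auto simp: a'_def)
  also have "F (single m (a m)) x mod 3 = (a m * F (single 0 1) (x - M m)) mod 3"
    by (rule F_single[OF m c])
  finally show ?case
    by (simp only: sum.insert[OF insert.hyps] mod_add_eq add.commute)
qed

text \<open>Twisted conjugation by an element over \<open>y\<close> changes the exponent by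
  \<open>y - M y\<close>, on which the invariant functional vanishes. Its values on multiples of the
  unit vector at \<open>i\<close> are distinct.\<close>

lemma infinite_classes_functional:
  fixes w :: "nat \<Rightarrow> real"
  assumes i: "i < k" "w i \<noteq> 0"
    and inv: "\<And>z. z \<in> zk k \<Longrightarrow> (\<Sum>j<k. w j * of_int (M z j)) = (\<Sum>j<k. w j * of_int (z j))"
  shows "infinite (reidemeister_classes (wreath k) \<phi>)"
proof (rule infinite_reidemeister_classesI[OF group_wreath hom])
  define L where "L z = (\<Sum>j<k. w j * of_int (z j))" for z :: "nat \<Rightarrow> int"
  have L_add: "L (x + y) = L x + L y" for x y
    by (simp add: L_def algebra_simps sum.distrib)
  have L_single: "L (single i c) = w i * of_int c" for c
  proof -
    have "L (single i c) = (\<Sum>j<k. if j = i then w i * of_int c else 0)"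
      unfolding L_def by (intro sum.cong) auto
    thus ?thesis
      using i by simp
  qed
  fix m n :: nat
  show "(0, single i (int m)) \<in> carrier (wreath k)"
    using i by (simp only: wreath_carrier mem_Times_iff fst_conv snd_conv lamp_zero single_in_zk simp_thms)
  assume "((0, single i (int m)), (0, single i (int n))) \<in> twisted_conj (wreath k) \<phi>"
  then obtain b y where h: "b \<in> lamp k" "y \<in> zk k"
    and eq: "(0, single i (int n)) = (b, y) \<otimes>\<^bsub>wreath k\<^esub> (0, single i (int m))
      \<otimes>\<^bsub>wreath k\<^esub> \<phi> (inv\<^bsub>wreath k\<^esub> (b, y))"
    by (auto simp: twisted_conj_def wreath_carrier simp del: single_apply)
  obtain b' where b': "inv\<^bsub>wreath k\<^esub> (b, y) = (b', - y)" "b' \<in> lamp k"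
    using wreath_inverse_closed[OF h] wreath_inv[OF h] by (simp add: wreath_carrier)
  have "snd (\<phi> (b', - y)) = M (- y)"
    by (rule snd_phi[OF b'(2) zk_uminus[OF h(2)]])
  hence "single i (int n) = y + single i (int m) + M (- y)"
    using eq unfolding b'(1)
    by (cases "\<phi> (b', - y)") (simp add: wreath_mult del: single_apply)
  hence "single i (int n) + M y = y + single i (int m)"
    using top.uminus[OF h(2)] by (simp del: single_apply)
  hence "L (single i (int n)) + L (M y) = L y + L (single i (int m))"
    by (metis L_add)
  moreover have "L (M y) = L y"
    using inv[OF h(2)] by (simp add: L_def)
  ultimately show "m = n"
    using i(2) by (simp add: L_single)
qed

end

section \<open>Orbits of a twisted shift\<close>

lemma funpow_closed:
  assumes "\<forall>z\<in>Z. f z \<in> Z" "z \<in> Z"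
  shows "(f ^^ i) z \<in> Z"
  using assms by (induction i) simp_all

lemma funpow_inverse:
  assumes "\<forall>z\<in>Z. f z \<in> Z" "\<forall>z\<in>Z. g (f z) = z" "z \<in> Z"
  shows "(g ^^ i) ((f ^^ i) z) = z"
proof (induction i)
  case (Suc i)
  have "(g ^^ Suc i) ((f ^^ Suc i) z) = (g ^^ i) (g (f ((f ^^ i) z)))"
    by (simp add: funpow_Suc_right del: funpow.simps(2)) (simp flip: funpow_swap1)
  thus ?case
    using Suc assms(2) funpow_closed[OF assms(1,3)] by simp
qed simp

text \<open>Cancelling \<open>i\<close> applications of \<open>f\<close> by means of
  \<open>g\<close> turns a coincidence at \<open>i < j\<close> into a period
  \<open>j - i\<close>.\<close>

lemma inj_orbit:
  assumes "\<forall>z\<in>Z. f z \<in> Z" "\<forall>z\<in>Z. g (f z) = z" "w \<in> Z" "\<And>j. j > 0 \<Longrightarrow> (f ^^ j) w \<noteq> w"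
  shows "inj (\<lambda>i. (f ^^ i) w)"
proof (rule linorder_injI)
  fix i j :: nat assume "i < j"
  hence "(f ^^ j) w = (f ^^ i) ((f ^^ (j - i)) w)"
    by (simp flip: funpow_add o_apply[of "f ^^ i"])
  hence "(g ^^ i) ((f ^^ j) w) = (f ^^ (j - i)) w"
    using funpow_inverse[OF assms(1,2) funpow_closed[OF assms(1,3)]] by simp
  thus "(f ^^ i) w \<noteq> (f ^^ j) w"
    using assms(4)[of "j - i"] \<open>i < j\<close> funpow_inverse[OF assms(1-3), of i] by auto
qed

lemma inj_avoids_finite_set:
  assumes "inj (h :: nat \<Rightarrow> 'a)" "finite S"
  obtains i where "h i \<notin> S"
  using assms finite_subset range_inj_infinite by (metis image_subsetI)

text \<open>Following \<open>step\<close> once around a finite orbit, whose length is even, gives \<open>b w + 1 = b w\<close> modulo 3;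
  along an infinite orbit, \<open>b\<close> vanishes from \<open>w\<close> onwards and then nowhere before \<open>w\<close>.\<close>

lemma orbit_obstruction:
  fixes b :: "'a \<Rightarrow> int" and e :: int
  assumes fg: "\<forall>z\<in>Z. f z \<in> Z" "\<forall>z\<in>Z. g z \<in> Z" "\<forall>z\<in>Z. g (f z) = z" "\<forall>z\<in>Z. f (g z) = z"
    and w: "w \<in> Z"
    and b: "\<And>z. b z mod 3 = b z" "finite {z. b z \<noteq> 0}"
    and e: "e = 1 \<or> e = -1"
    and period: "\<And>j. (f ^^ j) w = w \<Longrightarrow> even j"
    and w': "\<And>j. (f ^^ j) w \<noteq> w'" "\<And>j. (g ^^ j) w \<noteq> w'"
    and step: "\<And>z. z \<in> Z \<Longrightarrow> f z \<noteq> w' \<Longrightarrow> [b (f z) + (if f z = w then 1 else 0) = e * b z] (mod 3)"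
  shows False
proof (cases "\<exists>p>0. (f ^^ p) w = w")
  case True
  \<comment> \<open>With the least period, the correction at \<open>w\<close> enters exactly once,
    when the orbit closes.\<close>
  define p where "p = (LEAST p. p > 0 \<and> (f ^^ p) w = w)"
  have p: "p > 0" "(f ^^ p) w = w"
    using LeastI_ex[OF True] by (auto simp: p_def)
  have min: "(f ^^ i) w \<noteq> w" if "0 < i" "i < p" for i
    using that not_less_Least[of i "\<lambda>p. p > 0 \<and> (f ^^ p) w = w"] by (auto simp: p_def)
  have c: "[b ((f ^^ i) w) = e ^ i * b w] (mod 3)" if "i < p" for i
    using that
  proof (induction i)
    case (Suc i)
    have "[b ((f ^^ Suc i) w) = e * b ((f ^^ i) w)] (mod 3)"
      using step[of "(f ^^ i) w"] funpow_closed[OF fg(1) w, of i] min[of "Suc i"] w'(1)[of "Suc i"] Suc.prems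
      by simp
    also have "[e * b ((f ^^ i) w) = e * (e ^ i * b w)] (mod 3)"
      using Suc by (intro cong_scalar_left) simp
    finally show ?case by (simp add: mult.assoc)
  qed simp
  obtain q where q: "p = Suc q"
    using p(1) gr0_implies_Suc by blast
  have "[b w + 1 = e * b ((f ^^ q) w)] (mod 3)"
    using step[of "(f ^^ q) w"] funpow_closed[OF fg(1) w, of q] p(2) w'(1)[of p] by (simp add: q)
  also have "[e * b ((f ^^ q) w) = e * (e ^ q * b w)] (mod 3)"
    using c q by (intro cong_scalar_left) simp
  \<comment> \<open>The period \<open>p = Suc q\<close> is even, so \<open>e ^ p = 1\<close> for
    both signs.\<close>
  also have "e * (e ^ q * b w) = b w"
    using period[OF p(2)] e by (auto simp: q mult.assoc[symmetric] simp flip: power_Suc)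
  finally have "[1 = 0 :: int] (mod 3)"
    using cong_add_lcancel_0[of "b w" 1 3] by simp
  thus False
    by (simp add: cong_def)
next
  case False
  hence no_period: "(f ^^ j) w \<noteq> w" if "j > 0" for j
    using that by blast
  have no_period': "(g ^^ j) w \<noteq> w" if "j > 0" for j
    using funpow_inverse[OF fg(2,4) w, of j] no_period[OF that] by metis
  \<comment> \<open>The forward orbit is infinite, so it leaves the finite support of
    \<open>b\<close>; transporting this zero back gives \<open>b w = 0\<close>.\<close>
  obtain i where i: "b ((f ^^ i) w) = 0"
    using inj_avoids_finite_set[OF inj_orbit[OF fg(1,3) w no_period] b(2)] by blast
  have "[b ((f ^^ i) w) = e ^ i * b w] (mod 3)"
  proof (induction i)
    case (Suc i)
    have "[b ((f ^^ Suc i) w) = e * b ((f ^^ i) w)] (mod 3)"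
      using step[of "(f ^^ i) w"] funpow_closed[OF fg(1) w, of i] no_period[of "Suc i"] w'(1)[of "Suc i"]
      by simp
    also have "[e * b ((f ^^ i) w) = e * (e ^ i * b w)] (mod 3)"
      using Suc by (intro cong_scalar_left)
    finally show ?case by (simp add: mult.assoc)
  qed simp
  hence "[e ^ i * b w = 0] (mod 3)"
    by (simp add: i cong_sym_eq)
  hence "b w mod 3 = 0"
    using e by (cases "even i") (auto simp: cong_def)
  hence bw: "b w = 0"
    using b(1) by metis
  \<comment> \<open>The index starts at \<open>Suc i\<close> because the correction 1 arises on the
    step from \<open>g w\<close> to \<open>w\<close>, where \<open>b w = 0\<close>; further back no
    correction occurs.\<close>
  have c: "[e ^ Suc i * b ((g ^^ Suc i) w) = 1] (mod 3)" for i
  proof (induction i)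
    case 0
    show ?case
      using step[of "g w"] fg(2,4) w w'(1)[of 0] bw by (auto simp: cong_sym_eq)
  next
    case (Suc i)
    have z: "(g ^^ Suc i) w \<in> Z"
      using funpow_closed[OF fg(2) w] .
    have "[b ((g ^^ Suc i) w) = e * b ((g ^^ Suc (Suc i)) w)] (mod 3)"
      using step[of "(g ^^ Suc (Suc i)) w"] fg(2,4) z no_period'[of "Suc i"] w'(2)[of "Suc i"]
      by simp
    hence "[e ^ Suc i * b ((g ^^ Suc i) w) = e ^ Suc i * (e * b ((g ^^ Suc (Suc i)) w))] (mod 3)"
      by (rule cong_scalar_left)
    with Suc have "[1 = e ^ Suc i * (e * b ((g ^^ Suc (Suc i)) w))] (mod 3)"
      using cong_sym cong_trans by blast
    thus ?case
      by (simp add: cong_sym_eq mult_ac)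
  qed
  have "inj (\<lambda>i. (g ^^ Suc i) w)"
    using inj_compose[OF inj_orbit[OF fg(2,4) w no_period'] inj_Suc] by (simp only: comp_def)
  then obtain j where "b ((g ^^ Suc j) w) = 0"
    using inj_avoids_finite_set[OF _ b(2)] by blast
  thus False
    using c[of j] by (simp add: cong_def)
qed

section \<open>Automorphisms of the wreath product\<close>

lemma (in zk_endo) funpow_scale:
  assumes "x \<in> zk k"
  shows "(M ^^ j) (\<lambda>i. c * x i) = (\<lambda>i. c * (M ^^ j) x i)"
proof (induction j)
  case (Suc j)
  thus ?case
    using scale[of "(M ^^ j) x" c] funpow_closed[of "zk k" M x j] closed assms by simp
qed simp

text \<open>Powers of \<open>M\<close> commute with multiplication by \<open>c\<close>. Used for
  \<open>M\<close> and its inverse, this separates the orbits of distinct positive multiples of a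
  unit vector.\<close>

lemma (in zk_endo) funpow_single_dvd:
  assumes "i < k" "(M ^^ j) (single i c) = single i d"
  shows "c dvd d"
proof -
  have "single i c = (\<lambda>l. c * single i 1 l)"
    by (rule ext) simp
  hence "(M ^^ j) (single i c) i = c * (M ^^ j) (single i 1) i"
    using funpow_scale[OF single_in_zk[OF assms(1)], of j c 1] by (simp only:)
  moreover have "single i d i = d"
    by simp
  ultimately show ?thesis
    using assms(2) by (metis dvd_triv_left)
qed

text \<open>Negation reverses the order, so \<open>p\<close> is both the largest and the smallest
  element of \<open>P\<close>.\<close>

lemma uminus_image_collapse:
  fixes P :: "(nat \<Rightarrow> int) set"
  assumes "\<forall>x\<in>P. x = p \<or> less_fun x p" "\<forall>x\<in>uminus ` P. x = - p \<or> less_fun x (- p)"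
  shows "P \<subseteq> {p}"
proof
  fix x assume x: "x \<in> P"
  show "x \<in> {p}"
  proof (rule ccontr)
    assume "x \<notin> {p}"
    hence "less_fun x p" "less_fun (- x) (- p)"
      using assms x by auto
    from less_fun_add_mono[OF this(2), of "x + p"] have "less_fun p x"
      by (simp add: algebra_simps)
    thus False
      using \<open>less_fun x p\<close> less_fun_asym by blast
  qed
qed

locale wreath_aut = wreath_hom k \<phi> + inverse: wreath_hom k \<psi> for k \<phi> \<psi> +
  assumes left_inverse: "g \<in> carrier (wreath k) \<Longrightarrow> \<psi> (\<phi> g) = g"
    and right_inverse: "g \<in> carrier (wreath k) \<Longrightarrow> \<phi> (\<psi> g) = g"
begin

lemma M_left_inverse:
  assumes "y \<in> zk k"
  shows "inverse.M (M y) = y"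
proof -
  have "\<phi> (0, y) = (fst (\<phi> (0, y)), M y)"
    by (simp add: M_def)
  hence "snd (\<psi> (\<phi> (0, y))) = inverse.M (M y)"
    using inverse.snd_phi[OF phi_closed(1)[of 0 y] top.closed[OF assms]] assms by simp
  thus ?thesis
    using left_inverse[of "(0, y)"] assms by (simp add: wreath_carrier)
qed

lemma F_right_inverse:
  assumes "a \<in> lamp k"
  shows "F (inverse.F a) = a"
  using right_inverse[of "(a, 0)"] assms
  by (simp add: wreath_carrier inverse.phi_lamp F_def)

lemma M_inj: "x \<in> zk k \<Longrightarrow> y \<in> zk k \<Longrightarrow> M x = M y \<longleftrightarrow> x = y"
  using M_left_inverse by metis

text \<open>The only units of the group ring of \<open>\<int>\<^sup>k\<close> over a field are the monomials.\<close>

lemma F_unit: "\<exists>p e. p \<in> zk k \<and> (e = 1 \<or> e = -1) \<and> (\<forall>x. F (single 0 1) x mod 3 = single p e x mod 3)"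
proof -
  define u where "u = F (single 0 1)"
  define v where "v = inverse.F (single 0 1)"
  have \<delta>: "single 0 1 \<in> lamp k"
    by (intro lamp_single) simp_all
  have u: "u \<in> lamp k" and v: "v \<in> lamp k"
    using F_closed[OF \<delta>] inverse.F_closed[OF \<delta>] by (simp_all only: u_def v_def)
  define P where "P = {x. u x \<noteq> 0}"
  define V where "V = {x. v x \<noteq> 0}"
  have P: "finite P" "P \<subseteq> zk k" and V: "finite V" "V \<subseteq> zk k"
    using lamp_D(2,3)[OF u] lamp_D(2,3)[OF v] by (auto simp: P_def V_def)
  \<comment> \<open>Expanding \<open>F (inverse.F \<delta>) = \<delta>\<close>, with \<delta> the
    generator at 0: the product of \<open>u\<close> with the transport of \<open>v\<close> along
    \<open>M\<close> is the unit of the group ring.\<close>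
  have conv: "(\<Sum>m\<in>V. v m * u (x - M m)) mod 3 = single 0 1 x mod 3" for x
    using F_expand[OF V v, of x] F_right_inverse[OF \<delta>] by (simp only: V_def u_def v_def order.refl simp_thms)
  \<comment> \<open>At a sum attained only once the product has the single term
    \<open>v l * u p\<close>, nonzero modulo 3; the unit, however, is supported at 0.\<close>
  have key: "p + q = 0" if pq: "p \<in> P" "q \<in> M ` V"
    and uniq: "\<forall>x\<in>P. \<forall>y\<in>M ` V. x + y = p + q \<longrightarrow> x = p \<and> y = q" for p q
  proof (rule ccontr)
    assume nz: "p + q \<noteq> 0"
    obtain l where l: "l \<in> V" "q = M l"
      using pq(2) by blast
    have "(\<Sum>m\<in>V. v m * u (p + q - M m)) = (\<Sum>m\<in>V. if m = l then v l * u p else 0)"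
    proof (rule sum.cong)
      fix m assume m: "m \<in> V"
      show "v m * u (p + q - M m) = (if m = l then v l * u p else 0)"
      proof (cases "u (p + q - M m) = 0")
        case True
        thus ?thesis using pq(1) l(2) by (auto simp: P_def)
      next
        case False
        hence "p + q - M m \<in> P"
          by (simp only: P_def mem_Collect_eq not_False_eq_True)
        from uniq[rule_format, OF this imageI[OF m] diff_add_cancel] have "M m = M l"
          using l(2) by (simp only:)
        hence "m = l"
          using M_inj[of m l] subsetD[OF V(2) m] subsetD[OF V(2) l(1)] by (simp only: simp_thms)
        thus ?thesis using l(2) by simp
      qed
    qed simp
    also have "\<dots> = v l * u p"
      using V(1) l(1) by simp
    finally have "(v l * u p) mod 3 = 0"
      using conv[of "p + q"] nz by simp
    thus False
      using lamp_D(1)[OF v, of l] lamp_D(1)[OF u, of p] l(1) pq(1) by (auto simp: V_def P_def)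
  qed
  have "P \<noteq> {}"
  proof
    assume "P = {}"
    hence "u x = 0" for x
      by (auto simp: P_def)
    thus False
      using conv[of 0] by simp
  qed
  have "V \<noteq> {}"
  proof
    assume "V = {}"
    thus False
      using conv[of 0] by simp
  qed
  have "finite (M ` V)" "M ` V \<noteq> {}"
    using V(1) \<open>V \<noteq> {}\<close> by simp_all
  from unique_sum[OF P(1) \<open>P \<noteq> {}\<close> this] obtain p q where pq: "p \<in> P" "q \<in> M ` V" "\<forall>x\<in>P. x = p \<or> less_fun x p"
    and pq_uniq: "\<forall>x\<in>P. \<forall>y\<in>M ` V. x + y = p + q \<longrightarrow> x = p \<and> y = q"
    by blast
  \<comment> \<open>Negating both supports turns the argument for largest elements into one for
    smallest elements.\<close>
  have "finite (uminus ` P)" "uminus ` P \<noteq> {}" "finite (uminus ` M ` V)" "uminus ` M ` V \<noteq> {}"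
    using P(1) V(1) \<open>P \<noteq> {}\<close> \<open>V \<noteq> {}\<close> by simp_all
  from unique_sum[OF this] obtain p' q' where pq': "p' \<in> uminus ` P" "q' \<in> uminus ` M ` V"
    "\<forall>x\<in>uminus ` P. x = p' \<or> less_fun x p'"
    and pq'_uniq: "\<forall>x\<in>uminus ` P. \<forall>y\<in>uminus ` M ` V. x + y = p' + q' \<longrightarrow> x = p' \<and> y = q'"
    by blast
  have "p + q = 0"
    by (rule key[OF pq(1,2) pq_uniq])
  moreover have "- p' + - q' = 0"
  proof (rule key)
    show "\<forall>x\<in>P. \<forall>y\<in>M ` V. x + y = - p' + - q' \<longrightarrow> x = - p' \<and> y = - q'"
    proof (intro ballI impI)
      fix x y assume xy: "x \<in> P" "y \<in> M ` V" "x + y = - p' + - q'"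
      hence "- x + - y = p' + q'"
        by (metis add.inverse_inverse minus_add_distrib)
      with xy pq'_uniq have "- x = p' \<and> - y = q'"
        by blast
      thus "x = - p' \<and> y = - q'"
        by auto
    qed
  qed (use pq'(1,2) in auto)
  \<comment> \<open>Both extreme sums are 0, hence equal, and uniqueness identifies the smallest
    element \<open>- p'\<close> of \<open>P\<close> with the largest one.\<close>
  ultimately have "- p' = p"
    using pq_uniq[rule_format, of "- p'" "- q'"] pq'(1,2) by auto
  hence "P \<subseteq> {p}"
    using uminus_image_collapse[OF pq(3)] pq'(3) by (metis minus_minus)
  hence u0: "u x = 0" if "x \<noteq> p" for x
    using that by (auto simp: P_def)
  have "u p \<in> {1, 2}"
    using lamp_D(1)[OF u, of p] pq(1) by (auto simp: P_def)
  define e :: int where "e = (if u p = 1 then 1 else -1)"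
  have "F (single 0 1) x mod 3 = single p e x mod 3" for x
    unfolding u_def[symmetric] using u0[of x] \<open>u p \<in> {1, 2}\<close> by (auto simp: e_def)
  moreover have "p \<in> zk k"
    using pq(1) P(2) by (rule rev_subsetD)
  moreover have "e = 1 \<or> e = -1"
    by (simp add: e_def)
  ultimately show ?thesis
    by (intro exI[of _ p] exI[of _ e] conjI allI)
qed

lemma F_monomial:
  obtains p e where "p \<in> zk k" "e = 1 \<or> e = -1"
    "\<And>a x. a \<in> lamp k \<Longrightarrow> x \<in> zk k \<Longrightarrow> F a (p + M x) = (e * a x) mod 3"
proof -
  obtain p e where pe: "p \<in> zk k" "e = 1 \<or> e = -1"
    and u: "\<And>x. F (single 0 1) x mod 3 = single p e x mod 3"
    using F_unit by blast
  have "F a (p + M x) = (e * a x) mod 3" if a: "a \<in> lamp k" and x: "x \<in> zk k" for a x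
  proof -
    \<comment> \<open>The point \<open>x\<close> is added so that the sum contains its only relevant
      index even when \<open>a x = 0\<close>.\<close>
    define A where "A = insert x {x. a x \<noteq> 0}"
    have A: "finite A" "A \<subseteq> zk k" "{x. a x \<noteq> 0} \<subseteq> A" "x \<in> A"
      using lamp_D(2,3)[OF a] x by (auto simp: A_def)
    have "F a (p + M x) = F a (p + M x) mod 3"
      using lamp_D(4)[OF F_closed[OF a]] by simp
    also have "\<dots> = (\<Sum>m\<in>A. a m * F (single 0 1) (p + M x - M m)) mod 3"
      by (rule F_expand[OF A(1,2) a A(3)])
    also have "\<dots> = (\<Sum>m\<in>A. (a m * F (single 0 1) (p + M x - M m)) mod 3) mod 3"
      by (rule mod_sum_eq[symmetric])
    also have "(\<Sum>m\<in>A. (a m * F (single 0 1) (p + M x - M m)) mod 3)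
        = (\<Sum>m\<in>A. if m = x then (a x * e) mod 3 else 0)"
    proof (rule sum.cong)
      fix m assume m: "m \<in> A"
      have "(a m * F (single 0 1) (p + M x - M m)) mod 3 = (a m * single p e (p + M x - M m)) mod 3"
        using u by (rule mod_mult_cong[OF refl])
      moreover have "p + M x - M m = p \<longleftrightarrow> m = x"
        using M_inj[OF x, of m] A(2) m by (auto simp: algebra_simps)
      ultimately show "(a m * F (single 0 1) (p + M x - M m)) mod 3 = (if m = x then (a x * e) mod 3 else 0)"
        by auto
    qed simp
    also have "\<dots> = (a x * e) mod 3"
      using A(1,4) by simp
    finally show ?thesis
      by (simp only: mult.commute mod_mod_trivial)
  qed
  with pe show ?thesis
    by (rule that)
qed

end

section \<open>Odd rank\<close>

context wreath_aut
begin

lemma M_right_inverse: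
  assumes "y \<in> zk k"
  shows "M (inverse.M y) = y"
proof -
  interpret swapped: wreath_aut k \<psi> \<phi>
    by unfold_locales (simp_all add: left_inverse right_inverse)
  show ?thesis
    by (rule swapped.M_left_inverse[OF assms])
qed

text \<open>The classes separated here lie over the single exponent \<open>- p\<close>. Absence of
  fixed vectors forces conjugators into the base group, where \<open>orbit_obstruction\<close>
  applies.\<close>

lemma infinite_classes_odd_order:
  fixes w :: "nat \<Rightarrow> real" and r :: real
  assumes i: "i < k" "w i \<noteq> 0" and r: "r \<noteq> 1"
    and w: "\<And>z. z \<in> zk k \<Longrightarrow> (\<Sum>j<k. w j * of_int (M z j)) = r * (\<Sum>j<k. w j * of_int (z j))"
    and fix_free: "\<And>y. y \<in> zk k \<Longrightarrow> M y = y \<Longrightarrow> y = 0"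
  shows "infinite (reidemeister_classes (wreath k) \<phi>)"
proof -
  obtain p e where p: "p \<in> zk k" and e: "e = 1 \<or> e = -1"
    and F: "\<And>a x. a \<in> lamp k \<Longrightarrow> x \<in> zk k \<Longrightarrow> F a (p + M x) = (e * a x) mod 3"
    using F_monomial by metis
  \<comment> \<open>The multiples start at 1, since the zero vector has the odd period 1.\<close>
  define v where "v n = single i (int (Suc n))" for n
  have v: "v n \<in> zk k" for n
    unfolding v_def by (rule single_in_zk[OF i(1)])
  have inv_closed: "\<forall>z\<in>zk k. M z \<in> zk k" "\<forall>z\<in>zk k. inverse.M z \<in> zk k"
    "\<forall>z\<in>zk k. inverse.M (M z) = z" "\<forall>z\<in>zk k. M (inverse.M z) = z"
    using top.closed inverse.top.closed M_left_inverse M_right_inverse by blast+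
  have L_single: "(\<Sum>j<k. w j * of_int (single i c j)) = w i * of_int c" for c
  proof -
    have "(\<Sum>j<k. w j * of_int (single i c j)) = (\<Sum>j<k. if j = i then w i * of_int c else 0)"
      by (intro sum.cong) auto
    thus ?thesis
      using i(1) by simp
  qed
  have L_pow: "(\<Sum>l<k. w l * of_int ((M ^^ j) z l)) = r ^ j * (\<Sum>l<k. w l * of_int (z l))"
    if "z \<in> zk k" for z j
    using w[OF funpow_closed[OF inv_closed(1) that]] by (induction j) simp_all
  have period: "even j" if j: "(M ^^ j) (v n) = v n" for n j
  proof (rule ccontr)
    assume "odd j"
    \<comment> \<open>The functional multiplies by \<open>r ^ j\<close> along the orbit and is
      nonzero on \<open>v n\<close>, because \<open>w i \<noteq> 0\<close>. For odd \<open>j\<close>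
      the only real solution is 1.\<close>
    have "r ^ j = 1"
      using L_pow[OF v, of j n] i(2) unfolding j unfolding v_def L_single by simp
    hence "r = root j 1"
      using odd_real_root_power_cancel[OF \<open>odd j\<close>, of r] by simp
    thus False
      using r odd_pos[OF \<open>odd j\<close>] by simp
  qed
  have dvd_eq: "m = n" if "int (Suc m) dvd int (Suc n)" "int (Suc n) dvd int (Suc m)" for m n
    using zdvd_antisym_nonneg[OF _ _ that] by simp
  \<comment> \<open>Applying powers of \<open>M\<close> and of its inverse gives divisibility in
    both directions.\<close>
  have orbit: "m = n" if j: "(M ^^ j) (v m) = v n" for m n j
  proof -
    have "(inverse.M ^^ j) (v n) = v m"
      using funpow_inverse[OF inv_closed(1,3) v, of j m] j by simp
    thus ?thesis
      using j dvd_eq top.funpow_single_dvd[OF i(1)] inverse.top.funpow_single_dvd[OF i(1)]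
      unfolding v_def by blast
  qed
  have orbit': "m = n" if j: "(inverse.M ^^ j) (v m) = v n" for m n j
    using funpow_inverse[OF inv_closed(2,4) v, of j m] orbit[of j n m] j by simp
  show ?thesis
  proof (rule infinite_reidemeister_classesI[OF group_wreath hom])
    fix m n :: nat
    have \<delta>: "single (v m) 1 \<in> lamp k"
      by (intro lamp_single v) simp
    \<comment> \<open>The exponent \<open>- p\<close> cancels the translation by \<open>p\<close> in
      the monomial form of \<open>F\<close>, so that the orbits are those of \<open>M\<close>
      itself.\<close>
    show "(single (v m) 1, - p) \<in> carrier (wreath k)"
      using \<delta> p by (simp only: wreath_carrier mem_Times_iff fst_conv snd_conv zk_uminus simp_thms)
    assume "((single (v m) 1, - p), (single (v n) 1, - p)) \<in> twisted_conj (wreath k) \<phi>"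
    then obtain b y where h: "b \<in> lamp k" "y \<in> zk k"
      and eq: "(single (v n) 1, - p) = (b, y) \<otimes>\<^bsub>wreath k\<^esub> (single (v m) 1, - p)
        \<otimes>\<^bsub>wreath k\<^esub> \<phi> (inv\<^bsub>wreath k\<^esub> (b, y))"
      unfolding twisted_conj_def wreath_carrier by blast
    define b' where "b' = (\<lambda>x. (- b (x + y)) mod 3)"
    have b': "inv\<^bsub>wreath k\<^esub> (b, y) = (b', - y)" "b' \<in> lamp k"
      using wreath_inverse_closed[OF h] wreath_inv[OF h] by (simp_all add: wreath_carrier b'_def)
    have "snd (\<phi> (b', - y)) = M (- y)"
      by (rule snd_phi[OF b'(2) zk_uminus[OF h(2)]])
    hence "- p = y + - p + M (- y)"
      using eq unfolding b'(1)
      by (cases "\<phi> (b', - y)") (simp add: wreath_mult del: single_apply)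
    hence "M y = y"
      using top.uminus[OF h(2)] by (simp add: algebra_simps)
    hence y: "y = 0"
      by (rule fix_free[OF h(2)])
    have "(single (v n) 1, - p) = (\<lambda>x. (b x + single (v m) 1 x + F b' (x + p)) mod 3, - p)"
      using eq unfolding b'(1) unfolding y
      by (simp add: phi_lamp[OF b'(2)] wreath_mult mod_simps del: single_apply)
    hence pt: "single (v n) 1 x = (b x + single (v m) 1 x + F b' (x + p)) mod 3" for x
      by (rule fun_cong[OF conjunct1[OF prod.inject[THEN iffD1]]])
    \<comment> \<open>The base component of the conjugacy equation, evaluated at \<open>M z\<close>;
      away from \<open>v n\<close> its left side vanishes.\<close>
    have step: "[b (M z) + (if M z = v m then 1 else 0) = e * b z] (mod 3)"
      if z: "z \<in> zk k" "M z \<noteq> v n" for z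
    proof -
      have "F b' (M z + p) = (e * b' z) mod 3"
        using F[OF b'(2) z(1)] by (simp add: add.commute)
      hence "(b (M z) + single (v m) 1 (M z) + (e * b' z) mod 3) mod 3 = 0"
        using pt[of "M z"] z(2) by simp
      moreover have "b' z = (- b z) mod 3"
        by (simp add: b'_def y)
      ultimately have "(b (M z) + single (v m) 1 (M z) - e * b z) mod 3 = 0"
        by (simp add: mod_simps del: single_apply)
      thus ?thesis
        by (simp add: cong_iff_dvd_diff mod_eq_0_iff_dvd)
    qed
    show "m = n"
    proof (rule ccontr)
      assume "m \<noteq> n"
      hence avoid: "(M ^^ j) (v m) \<noteq> v n" "(inverse.M ^^ j) (v m) \<noteq> v n" for j
        using orbit orbit' by blast+
      show False
        by (rule orbit_obstruction[OF inv_closed v lamp_D(4,3)[OF h(1)] e period avoid step])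
    qed
  qed
qed

lemma infinite_classes_odd:
  assumes "odd k"
  shows "infinite (reidemeister_classes (wreath k) \<phi>)"
proof -
  have eigen: "infinite (reidemeister_classes (wreath k) \<phi>)" if root: "poly (char_poly top.mat_of) 1 = 0"
  proof -
    obtain w :: "nat \<Rightarrow> real" and i where i: "i < k" "w i \<noteq> 0"
      and w: "\<And>z. z \<in> zk k \<Longrightarrow> (\<Sum>j<k. w j * of_int (M z j)) = 1 * (\<Sum>j<k. w j * of_int (z j))"
      using top.functional_of_root[OF root] by metis
    show ?thesis
      using w by (intro infinite_classes_functional[where w = w, OF i]) simp
  qed
  obtain r where r: "poly (char_poly top.mat_of) r = 0"
    using top.char_poly_root_odd[OF assms] by blast
  obtain w :: "nat \<Rightarrow> real" and i where i: "i < k" "w i \<noteq> 0"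
    and w: "\<And>z. z \<in> zk k \<Longrightarrow> (\<Sum>j<k. w j * of_int (M z j)) = r * (\<Sum>j<k. w j * of_int (z j))"
    using top.functional_of_root[OF r] by metis
  show ?thesis
  \<comment> \<open>A nonzero fixed vector makes 1 an eigenvalue, so both alternatives of the first
    case yield an invariant functional.\<close>
  proof (cases "r = 1 \<or> (\<exists>y\<in>zk k. M y = y \<and> y \<noteq> 0)")
    case True
    thus ?thesis
      using eigen r top.char_poly_fixed_point by blast
  next
    case False
    thus ?thesis
      by (intro infinite_classes_odd_order[where w = w, OF i _ w]) auto
  qed
qed

end

lemma R_infty_odd:
  assumes "odd k"
  shows "R_infty (wreath k)"
  unfolding R_infty_def
proof
  fix \<phi> assume iso: "\<phi> \<in> iso (wreath k) (wreath k)"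
  define \<psi> where "\<psi> = inv_into (carrier (wreath k)) \<phi>"
  have \<psi>: "\<psi> \<in> iso (wreath k) (wreath k)"
    unfolding \<psi>_def by (rule group.iso_set_sym[OF group_wreath iso])
  have bij: "bij_betw \<phi> (carrier (wreath k)) (carrier (wreath k))"
    using iso by (simp add: iso_def)
  interpret wreath_aut k \<phi> \<psi>
  proof
    show "\<phi> \<in> hom (wreath k) (wreath k)" "\<psi> \<in> hom (wreath k) (wreath k)"
      using iso \<psi> by (simp_all add: iso_def)
  qed (simp_all add: \<psi>_def bij_betw_inv_into_left[OF bij] bij_betw_inv_into_right[OF bij])
  show "infinite (reidemeister_classes (wreath k) \<phi>)"
    by (rule infinite_classes_odd[OF assms])
qed

theorem theorem4p1:
  fixes k :: nat
  assumes "k \<ge> 1"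
  shows "R_infty (wreath k) \<longleftrightarrow> odd k"
  using R_infty_odd not_R_infty_even by blast

end
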